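(* ${\sf GL}$ is strongly complete for the class of $\omega$-bouquets; i.e., every ${\sf GL}$-consistent set of formulae is satisfied at some point of some model based on an $\omega$-bouquet.
   Context: ${\sf GL}$ is the modal logic with axioms $\Box(\varphi\to\psi)\to(\Box\varphi\to\Box\psi)$ and $\Box(\Box\varphi\to\varphi)\to\Box\varphi$ and rules modus ponens and necessitation, over a countable set of propositional variables. Topological ($d$-)semantics: on a space $(X,\tau)$, a valuation $[\![\cdot]\!]$ assigns subsets of $X$ to formulae with $[\![\bot]\!]=\varnothing$, $[\![\neg\varphi]\!]=X\setminus[\![\varphi]\!]$, $[\![\varphi\wedge\psi]\!]=[\![\varphi]\!]\cap[\![\psi]\!]$, $[\![\Diamond\varphi]\!]=d[\![\varphi]\!]$, where $dA$ is the set of limit points of $A$. A tree is a transitive irreflexive relational structure $(T,R)$ in which each predecessor set is well-ordered and there is a unique $R$-minimal element (root); its upset topology $\tau_R$ consists of the upward-closed sets. For a countable converse well-founded tree $(T,R)$ with rank function $\rho$ with respect to $\tau_R$, $\sigma_R$ is the least topology extending $\tau_R$ such that whenever $\rho(w)$ is a limit ordinal, $(v_i)_{i<\omega}$ enumerates all daughters (immediate successors) of $w$ exactly once, and $n<\omega$, the set $\{w\}\cup\bigcup_{n<i}(\{v_i\}\cup R(v_i))$ is in $\sigma_R$. An $\omega$-bouquet is a space $(T,\sigma_R)$ for such a tree $(T,R)$. *)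

theory Defs
  imports "HOL-Analysis.Abstract_Topology" "HOL-Library.Countable_Set"
begin

section \<open>The logic GL\<close>

text \<open>
  The box is taken as primitive and the diamond as its dual. (With the diamond as the primitive
  and the box as an abbreviation, the two axioms would say nothing about formulae such as
  \<open>\<diamond>p\<close>, and an extra duality axiom would be needed.)
\<close>

datatype 'p fm =
    Var 'p
  | Bot
  | Neg "'p fm"
  | Con "'p fm" "'p fm"
  | Box "'p fm"

definition Imp :: "'p fm \<Rightarrow> 'p fm \<Rightarrow> 'p fm" where
  "Imp \<phi> \<psi> = Neg (Con \<phi> (Neg \<psi>))"

definition Dia :: "'p fm \<Rightarrow> 'p fm" where
  "Dia \<phi> = Neg (Box (Neg \<phi>))"

text \<open>Boolean evaluation in which variables and boxed formulae are the atoms.\<close>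

primrec bool_eval :: "('p fm \<Rightarrow> bool) \<Rightarrow> 'p fm \<Rightarrow> bool" where
  "bool_eval h (Var p) = h (Var p)"
| "bool_eval h Bot = False"
| "bool_eval h (Neg \<phi>) = (\<not> bool_eval h \<phi>)"
| "bool_eval h (Con \<phi> \<psi>) = (bool_eval h \<phi> \<and> bool_eval h \<psi>)"
| "bool_eval h (Box \<phi>) = h (Box \<phi>)"

definition tautology :: "'p fm \<Rightarrow> bool" where
  "tautology \<phi> \<longleftrightarrow> (\<forall>h. bool_eval h \<phi>)"

inductive GL :: "'p fm \<Rightarrow> bool" where
  taut: "tautology \<phi> \<Longrightarrow> GL \<phi>"
| K: "GL (Imp (Box (Imp \<phi> \<psi>)) (Imp (Box \<phi>) (Box \<psi>)))"
| Loeb: "GL (Imp (Box (Imp (Box \<phi>) \<phi>)) (Box \<phi>))"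
| MP: "GL (Imp \<phi> \<psi>) \<Longrightarrow> GL \<phi> \<Longrightarrow> GL \<psi>"
| Nec: "GL \<phi> \<Longrightarrow> GL (Box \<phi>)"

primrec Conj :: "'p fm list \<Rightarrow> 'p fm" where
  "Conj [] = Neg Bot"
| "Conj (\<phi> # \<phi>s) = Con \<phi> (Conj \<phi>s)"

definition GL_consistent :: "'p fm set \<Rightarrow> bool" where
  "GL_consistent \<Gamma> \<longleftrightarrow> \<not> (\<exists>\<phi>s. set \<phi>s \<subseteq> \<Gamma> \<and> GL (Imp (Conj \<phi>s) Bot))"


section \<open>Topological semantics\<close>

definition d_valuation :: "'a topology \<Rightarrow> ('p \<Rightarrow> 'a set) \<Rightarrow> bool" where
  "d_valuation X V \<longleftrightarrow> (\<forall>p. V p \<subseteq> topspace X)"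

primrec d_sem :: "'a topology \<Rightarrow> ('p \<Rightarrow> 'a set) \<Rightarrow> 'p fm \<Rightarrow> 'a set" where
  "d_sem X V (Var p) = V p"
| "d_sem X V Bot = {}"
| "d_sem X V (Neg \<phi>) = topspace X - d_sem X V \<phi>"
| "d_sem X V (Con \<phi> \<psi>) = d_sem X V \<phi> \<inter> d_sem X V \<psi>"
| "d_sem X V (Box \<phi>) = topspace X - X derived_set_of (topspace X - d_sem X V \<phi>)"

lemma d_sem_subset: "d_valuation X V \<Longrightarrow> d_sem X V \<phi> \<subseteq> topspace X"
  by (induction \<phi>) (auto simp: d_valuation_def)

lemma d_sem_Dia:
  assumes "d_valuation X V"
  shows "d_sem X V (Dia \<phi>) = X derived_set_of (d_sem X V \<phi>)"
  using d_sem_subset[OF assms, of \<phi>] derived_set_of_subset_topspace[of X "d_sem X V \<phi>"]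
  by (simp add: Dia_def double_diff)


section \<open>Countable ordinals and rank\<close>

text \<open>
  The type of countable ordinals, with order type \<open>\<omega>\<^sub>1\<close>. It is used for the ranks of points of
  countable scattered spaces, which are countable ordinals.
\<close>

typedef cord = "Field (cardSuc natLeq)"
proof -
  have "\<not> finite (Field (cardSuc natLeq))"
    using cardSuc_finite[OF natLeq_Card_order] by (simp add: Field_natLeq)
  then show ?thesis
    by (metis ex_in_conv finite.emptyI)
qed

instantiation cord :: wellorder
begin

definition less_eq_cord :: "cord \<Rightarrow> cord \<Rightarrow> bool" where
  "\<alpha> \<le> \<beta> \<longleftrightarrow> (Rep_cord \<alpha>, Rep_cord \<beta>) \<in> cardSuc natLeq"

definition less_cord :: "cord \<Rightarrow> cord \<Rightarrow> bool" where
  "\<alpha> < \<beta> \<longleftrightarrow> \<alpha> \<le> \<beta> \<and> \<not> \<beta> \<le> (\<alpha>::cord)"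

instance
proof -
  let ?r = "cardSuc natLeq"
  have wo: "Well_order ?r"
    using cardSuc_Card_order[OF natLeq_Card_order] card_order_on_well_order_on by blast
  then have refl: "refl_on (Field ?r) ?r" and tr: "trans ?r" and anti: "antisym ?r"
    and tot: "total_on (Field ?r) ?r" and wf: "wf (?r - Id)"
    by (auto simp: order_on_defs)
  have refl': "\<alpha> \<le> \<alpha>" for \<alpha> :: cord
    using refl Rep_cord by (auto simp: less_eq_cord_def refl_on_def)
  have anti': "\<alpha> = \<beta>" if "\<alpha> \<le> \<beta>" "\<beta> \<le> \<alpha>" for \<alpha> \<beta> :: cord
    using that anti unfolding less_eq_cord_def by (metis antisymD Rep_cord_inject)
  show "OFCLASS(cord, wellorder_class)"
  proof
    fix \<alpha> \<beta> \<gamma> :: cord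
    show "\<alpha> < \<beta> \<longleftrightarrow> \<alpha> \<le> \<beta> \<and> \<not> \<beta> \<le> \<alpha>"
      by (rule less_cord_def)
    show "\<alpha> \<le> \<alpha>"
      by (rule refl')
    show "\<alpha> \<le> \<gamma>" if "\<alpha> \<le> \<beta>" "\<beta> \<le> \<gamma>"
      using that tr by (auto simp: less_eq_cord_def dest: transD)
    show "\<alpha> = \<beta>" if "\<alpha> \<le> \<beta>" "\<beta> \<le> \<alpha>"
      using that by (rule anti')
    show "\<alpha> \<le> \<beta> \<or> \<beta> \<le> \<alpha>"
      using tot refl' Rep_cord[of \<alpha>] Rep_cord[of \<beta>]
      by (cases "\<alpha> = \<beta>") (auto simp: less_eq_cord_def total_on_def Rep_cord_inject)
  next
    fix P :: "cord \<Rightarrow> bool" and \<alpha> :: cord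
    assume step: "\<And>\<alpha>. (\<And>\<beta>. \<beta> < \<alpha> \<Longrightarrow> P \<beta>) \<Longrightarrow> P \<alpha>"
    have "wf (inv_image (?r - Id) Rep_cord)"
      using wf by (rule wf_inv_image)
    then show "P \<alpha>"
    proof (induction \<alpha> rule: wf_induct_rule)
      case (less \<alpha>)
      show ?case
      proof (rule step)
        fix \<beta> assume "\<beta> < \<alpha>"
        then have "(\<beta>, \<alpha>) \<in> inv_image (?r - Id) Rep_cord"
          by (auto simp: less_cord_def less_eq_cord_def)
        then show "P \<beta>"
          by (rule less)
      qed
    qed
  qed
qed

end

lemma countable_cord_bounded:
  fixes A :: "cord set"
  assumes "countable A"
  shows "\<exists>\<beta>. \<forall>\<alpha>\<in>A. \<alpha> < \<beta>"
proof -
  let ?r = "cardSuc natLeq"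
  have inf: "\<not> finite (Field natLeq)" and co: "Card_order ?r"
    using cardSuc_Card_order[OF natLeq_Card_order] by (simp_all add: Field_natLeq)
  then have inf': "\<not> finite (Field ?r)"
    using cardSuc_finite[OF natLeq_Card_order] by simp
  have wo: "Well_order ?r"
    using co card_order_on_well_order_on by blast
  then have refl: "refl_on (Field ?r) ?r" and tr: "trans ?r"
    by (auto simp: order_on_defs)
  let ?As = "\<lambda>i. {x. (x, i) \<in> ?r}"
  have "countable (Rep_cord ` A)"
    using assms by simp
  then have "(card_of (Rep_cord ` A), natLeq) \<in> ordLeq"
    using card_of_ordLeq[of "Rep_cord ` A" "UNIV :: nat set"] ordLeq_ordIso_trans[OF _ card_of_nat]
    unfolding countable_def by (metis subset_UNIV)
  moreover have "relChain ?r ?As"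
    using tr unfolding relChain_def trans_def by blast
  moreover have "Rep_cord ` A \<subseteq> (\<Union>i\<in>Field ?r. ?As i)"
    using refl Rep_cord by (auto simp: refl_on_def)
  ultimately obtain i where i: "i \<in> Field ?r" "Rep_cord ` A \<subseteq> ?As i"
    using cardSuc_UNION[OF natLeq_Card_order inf, of ?As "Rep_cord ` A"] by blast
  obtain j where j: "j \<in> Field ?r" "i \<noteq> j" "(i, j) \<in> ?r"
    using infinite_Card_order_limit[OF co inf' i(1)] by blast
  have "\<alpha> \<le> Abs_cord i" if "\<alpha> \<in> A" for \<alpha>
    using that i by (auto simp: less_eq_cord_def Abs_cord_inverse)
  moreover have "Abs_cord i \<le> Abs_cord j" "Abs_cord i \<noteq> Abs_cord j"
    using i j by (auto simp: less_eq_cord_def Abs_cord_inverse Abs_cord_inject)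
  ultimately show ?thesis
    by (meson order_le_imp_less_or_eq order_le_less_trans)
qed

definition limit_ordinal :: "'o::wellorder \<Rightarrow> bool" where
  "limit_ordinal \<alpha> \<longleftrightarrow> (\<exists>\<beta>. \<beta> < \<alpha>) \<and> (\<forall>\<beta><\<alpha>. \<exists>\<gamma>. \<beta> < \<gamma> \<and> \<gamma> < \<alpha>)"

text \<open>
  The Cantor--Bendixson sequence \<open>d\<^sup>\<alpha>X\<close>. The usual zero, successor and limit clauses are
  derived below.
\<close>

function cb_seq :: "'a topology \<Rightarrow> 'o::wellorder \<Rightarrow> 'a set" where
  "cb_seq X \<alpha> = topspace X \<inter> (\<Inter>\<beta>\<in>{..<\<alpha>}. X derived_set_of (cb_seq X \<beta>))"
  by auto
termination
  by (relation "inv_image {(\<beta>, \<alpha>). \<beta> < \<alpha>} snd") (auto intro: wf_inv_image wf)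

declare cb_seq.simps [simp del]

lemma cb_seq_antimono: "\<alpha> \<le> \<beta> \<Longrightarrow> cb_seq X \<beta> \<subseteq> cb_seq X \<alpha>"
  by (subst (1 2) cb_seq.simps) auto

lemma cb_seq_zero:
  assumes "\<And>\<beta>. \<not> \<beta> < \<alpha>"
  shows "cb_seq X \<alpha> = topspace X"
  using assms by (subst cb_seq.simps) auto

lemma cb_seq_succ:
  assumes "\<alpha> < \<beta>" and "\<And>\<gamma>. \<gamma> < \<beta> \<Longrightarrow> \<gamma> \<le> \<alpha>"
  shows "cb_seq X \<beta> = X derived_set_of (cb_seq X \<alpha>)"
proof
  show "cb_seq X \<beta> \<subseteq> X derived_set_of (cb_seq X \<alpha>)"
    using assms by (subst cb_seq.simps) auto
  show "X derived_set_of (cb_seq X \<alpha>) \<subseteq> cb_seq X \<beta>"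
    using derived_set_of_mono[OF cb_seq_antimono[OF assms(2)], of _ X]
      derived_set_of_subset_topspace[of X "cb_seq X \<alpha>"]
    by (subst (2) cb_seq.simps) auto
qed

lemma cb_seq_limit:
  assumes "limit_ordinal \<alpha>"
  shows "cb_seq X \<alpha> = (\<Inter>\<beta>\<in>{..<\<alpha>}. cb_seq X \<beta>)"
proof
  show "cb_seq X \<alpha> \<subseteq> (\<Inter>\<beta>\<in>{..<\<alpha>}. cb_seq X \<beta>)"
    by (intro INT_greatest cb_seq_antimono) auto
  show "(\<Inter>\<beta>\<in>{..<\<alpha>}. cb_seq X \<beta>) \<subseteq> cb_seq X \<alpha>"
  proof
    fix x assume x: "x \<in> (\<Inter>\<beta>\<in>{..<\<alpha>}. cb_seq X \<beta>)"
    have "x \<in> X derived_set_of (cb_seq X \<beta>)" if less: "\<beta> < \<alpha>" for \<beta>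
    proof -
      obtain \<gamma> where "\<beta> < \<gamma>" "\<gamma> < \<alpha>"
        using assms less unfolding limit_ordinal_def by blast
      then have "x \<in> cb_seq X \<gamma>"
        using x by blast
      then show ?thesis
        using \<open>\<beta> < \<gamma>\<close> unfolding cb_seq.simps[of X \<gamma>] by blast
    qed
    moreover obtain \<beta> where "\<beta> < \<alpha>"
      using assms unfolding limit_ordinal_def by blast
    ultimately show "x \<in> cb_seq X \<alpha>"
      using derived_set_of_subset_topspace[of X "cb_seq X \<beta>"]
      unfolding cb_seq.simps[of X \<alpha>] by blast
  qed
qed

text \<open>The least \<open>\<alpha>\<close> such that \<open>x \<notin> d\<^sup>\<alpha>\<^sup>+\<^sup>1X\<close>.\<close>

definition cb_rank :: "'a topology \<Rightarrow> 'a \<Rightarrow> cord" where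
  "cb_rank X x = (LEAST \<alpha>. x \<notin> X derived_set_of (cb_seq X \<alpha>))"


section \<open>Bouquets\<close>

definition tree :: "'a set \<Rightarrow> 'a rel \<Rightarrow> bool" where
  "tree T R \<longleftrightarrow> R \<subseteq> T \<times> T \<and> trans R \<and> irrefl R \<and>
     (\<forall>w\<in>T. let P = {v. (v, w) \<in> R} in well_order_on P (Restr (R\<^sup>=) P)) \<and>
     (\<exists>!r. r \<in> T \<and> (\<forall>v. (v, r) \<notin> R))"

definition upset_topology :: "'a set \<Rightarrow> 'a rel \<Rightarrow> 'a topology" where
  "upset_topology T R = topology (\<lambda>U. U \<subseteq> T \<and> (\<forall>v w. v \<in> U \<and> (v, w) \<in> R \<longrightarrow> w \<in> U))"

lemma openin_upset_topology:
  "openin (upset_topology T R) U \<longleftrightarrow> U \<subseteq> T \<and> (\<forall>v w. v \<in> U \<and> (v, w) \<in> R \<longrightarrow> w \<in> U)"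
proof -
  have "istopology (\<lambda>U. U \<subseteq> T \<and> (\<forall>v w. v \<in> U \<and> (v, w) \<in> R \<longrightarrow> w \<in> U))"
    unfolding istopology_def by blast
  then show ?thesis
    by (simp add: upset_topology_def topology_inverse')
qed

definition daughters :: "'a rel \<Rightarrow> 'a \<Rightarrow> 'a set" where
  "daughters R w = {v. (w, v) \<in> R \<and> \<not> (\<exists>u. (w, u) \<in> R \<and> (u, v) \<in> R)}"

definition bouquet_topology :: "'a set \<Rightarrow> 'a rel \<Rightarrow> 'a topology" where
  "bouquet_topology T R = topology_generated_by
     ({U. openin (upset_topology T R) U} \<union>
      {{w} \<union> (\<Union>i\<in>{n<..}. {v i} \<union> R `` {v i}) | w n (v :: nat \<Rightarrow> 'a).
         w \<in> T \<and> limit_ordinal (cb_rank (upset_topology T R) w) \<and>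
         bij_betw v UNIV (daughters R w)})"

definition omega_bouquet :: "'a topology \<Rightarrow> bool" where
  "omega_bouquet X \<longleftrightarrow>
     (\<exists>T R. countable T \<and> tree T R \<and> wf (R\<inverse>) \<and> X = bouquet_topology T R)"

lemma topspace_bouquet_topology:
  assumes "tree T R"
  shows "topspace (bouquet_topology T R) = T"
proof -
  have RT: "R \<subseteq> T \<times> T"
    using assms by (simp add: tree_def)
  have "openin (upset_topology T R) T"
    using RT by (auto simp: openin_upset_topology)
  moreover have "U \<subseteq> T" if "openin (upset_topology T R) U" for U
    using that by (simp add: openin_upset_topology)
  moreover have "v i \<in> T" if "bij_betw v UNIV (daughters R w)" for v :: "nat \<Rightarrow> 'a" and w i
    using that RT by (auto simp: daughters_def bij_betw_def)
  ultimately show ?thesis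
    unfolding bouquet_topology_def topology_generated_by_topspace using RT by blast
qed

text \<open>
  On a countable converse well-founded tree every point has a rank below \<open>\<omega>\<^sub>1\<close>, so the
  least element in the definition of the rank exists.
\<close>

lemma cb_rank_exists:
  assumes "countable T" and "tree T R" and "wf (R\<inverse>)"
  shows "\<exists>\<alpha>::cord. w \<notin> upset_topology T R derived_set_of (cb_seq (upset_topology T R) \<alpha>)"
  using assms(3)
proof (induction w rule: wf_induct_rule)
  case (less w)
  let ?X = "upset_topology T R"
  have RT: "R \<subseteq> T \<times> T" and tr: "trans R"
    using assms(2) by (auto simp: tree_def)
  obtain f :: "'a \<Rightarrow> cord" where f: "\<And>v. (w, v) \<in> R \<Longrightarrow> v \<notin> ?X derived_set_of (cb_seq ?X (f v))"
    using less by (metis converseI)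
  have "countable (R `` {w})"
    using RT assms(1) by (auto intro!: countable_subset[of "R `` {w}" T])
  then obtain \<beta> where \<beta>: "\<And>v. (w, v) \<in> R \<Longrightarrow> f v < \<beta>"
    using countable_cord_bounded[of "f ` (R `` {w})"] by auto
  have no: "v \<notin> cb_seq ?X \<beta>" if "(w, v) \<in> R" for v
    using f[OF that] \<beta>[OF that] by (subst cb_seq.simps) auto
  have "w \<notin> ?X derived_set_of (cb_seq ?X \<beta>)"
  proof
    assume *: "w \<in> ?X derived_set_of (cb_seq ?X \<beta>)"
    then have "w \<in> T"
      using derived_set_of_subset_topspace[of ?X] openin_topspace[of ?X]
      unfolding openin_upset_topology by blast
    then have "openin ?X ({w} \<union> R `` {w})"
      using RT tr unfolding openin_upset_topology trans_def by blast
    with * obtain y where "y \<noteq> w" "y \<in> cb_seq ?X \<beta>" "y \<in> {w} \<union> R `` {w}"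
      unfolding in_derived_set_of by blast
    then show False
      using no by auto
  qed
  then show ?case
    by blast
qed

end

theory Submission
  imports Defs "HOL-Library.Extended_Nat" "HOL-Library.Sublist"
begin

text \<open>
  Extend the given set to a maximal consistent set \<open>\<Gamma>\<close>, and let the depth of a maximal consistent
  set be the least \<open>k\<close> such that it contains \<open>\<box>\<^sup>k\<bottom>\<close>, or \<open>\<infinity>\<close>. Any family of maximal consistent sets
  can be placed above a new root: the boxed formulae true there are dictated by the family, and the
  axioms of GL hold there because they hold in the family. By induction on the number of missing
  boxes it follows that every maximal consistent set agrees on any given finite set of formulae
  with one of finite depth.

  Unravel \<open>\<Gamma>\<close> into a tree of maximal consistent sets in which every \<open>\<box>\<psi>\<close> missing at a node is
  refuted at infinitely many daughters. All nodes except possibly the root have finite depth; if the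
  root has infinite depth, its daughters are only approximate successors, with an accuracy that
  improves along an enumeration of the daughters. Ranks grow strictly with depth, so a node of
  infinite depth has limit rank, and its neighbourhoods may omit any finite set of daughters: a box
  is true there as soon as the formula below it holds above almost all daughters. On the other hand
  every neighbourhood of every node contains almost all daughters, hence one which refutes a given
  missing box. This is the truth lemma.
\<close>

section \<open>Maximal consistent sets\<close>

lemma bool_eval_Imp [simp]: "bool_eval h (Imp \<phi> \<psi>) \<longleftrightarrow> (bool_eval h \<phi> \<longrightarrow> bool_eval h \<psi>)"
  by (simp add: Imp_def)

lemma bool_eval_Conj [simp]: "bool_eval h (Conj \<phi>s) \<longleftrightarrow> (\<forall>\<phi>\<in>set \<phi>s. bool_eval h \<phi>)"
  by (induction \<phi>s) auto

lemma GL_consequence: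
  assumes "GL \<phi>" and "\<And>h. bool_eval h \<phi> \<Longrightarrow> bool_eval h \<psi>"
  shows "GL \<psi>"
  using assms GL.MP[OF GL.taut, of \<phi> \<psi>] by (auto simp: tautology_def)

lemma GL_consequence2:
  assumes "GL \<phi>" "GL \<psi>" and "\<And>h. bool_eval h \<phi> \<Longrightarrow> bool_eval h \<psi> \<Longrightarrow> bool_eval h \<chi>"
  shows "GL \<chi>"
proof -
  have "GL (Imp \<psi> \<chi>)"
    by (rule GL_consequence[OF assms(1)]) (use assms(3) in auto)
  then show ?thesis
    using assms(2) by (rule GL.MP)
qed

lemma GL_Box_mono:
  assumes "GL (Imp \<phi> \<psi>)"
  shows "GL (Imp (Box \<phi>) (Box \<psi>))"
  using GL.MP[OF GL.K GL.Nec[OF assms]] .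

text \<open>Transitivity follows by applying Loeb's axiom to \<open>\<phi> \<and> \<box>\<phi>\<close>.\<close>

lemma GL_4: "GL (Imp (Box \<phi>) (Box (Box \<phi>)))"
proof -
  let ?\<theta> = "Con \<phi> (Box \<phi>)"
  have fst: "GL (Imp (Box ?\<theta>) (Box \<phi>))" and snd: "GL (Imp (Box ?\<theta>) (Box (Box \<phi>)))"
    by (rule GL_Box_mono, rule GL.taut, simp add: tautology_def)+
  have "GL (Imp \<phi> (Imp (Box ?\<theta>) ?\<theta>))"
    by (rule GL_consequence[OF fst]) auto
  then have "GL (Imp (Box \<phi>) (Box (Imp (Box ?\<theta>) ?\<theta>)))"
    by (rule GL_Box_mono)
  from this GL.Loeb have "GL (Imp (Box \<phi>) (Box ?\<theta>))"
    by (rule GL_consequence2) auto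
  from this snd show ?thesis
    by (rule GL_consequence2) auto
qed

lemma GL_Box_Conj:
  assumes "GL (Imp (Conj \<phi>s) \<psi>)"
  shows "GL (Imp (Conj (map Box \<phi>s)) (Box \<psi>))"
  using assms
proof (induction \<phi>s arbitrary: \<psi>)
  case Nil
  then have "GL \<psi>"
    by (rule GL_consequence) auto
  then have "GL (Box \<psi>)"
    by (rule GL.Nec)
  then show ?case
    by (rule GL_consequence) auto
next
  case (Cons \<phi> \<phi>s)
  then have "GL (Imp (Conj \<phi>s) (Imp \<phi> \<psi>))"
    by (auto elim: GL_consequence)
  from Cons.IH[OF this] GL.K show ?case
    by (rule GL_consequence2) auto
qed

definition derivable :: "'p fm set \<Rightarrow> 'p fm \<Rightarrow> bool" where
  "derivable \<Gamma> \<phi> \<longleftrightarrow> (\<exists>\<phi>s. set \<phi>s \<subseteq> \<Gamma> \<and> GL (Imp (Conj \<phi>s) \<phi>))"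

lemma GL_consistent_iff_not_derivable: "GL_consistent \<Gamma> \<longleftrightarrow> \<not> derivable \<Gamma> Bot"
  by (simp add: GL_consistent_def derivable_def)

lemma derivable_GL: "GL \<phi> \<Longrightarrow> derivable \<Gamma> \<phi>"
  unfolding derivable_def
  by (rule exI[of _ "[]"]) (auto elim: GL_consequence)

lemma derivable_assumption: "\<phi> \<in> \<Gamma> \<Longrightarrow> derivable \<Gamma> \<phi>"
  unfolding derivable_def
  by (rule exI[of _ "[\<phi>]"]) (auto intro: GL.taut simp: tautology_def)

lemma derivable_mono: "derivable \<Gamma> \<phi> \<Longrightarrow> \<Gamma> \<subseteq> \<Delta> \<Longrightarrow> derivable \<Delta> \<phi>"
  unfolding derivable_def by blast

lemma derivable_consequence2:
  assumes "derivable \<Gamma> \<phi>" "derivable \<Gamma> \<psi>"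
    and "\<And>h. bool_eval h \<phi> \<Longrightarrow> bool_eval h \<psi> \<Longrightarrow> bool_eval h \<chi>"
  shows "derivable \<Gamma> \<chi>"
proof -
  obtain \<phi>s \<psi>s where sub: "set \<phi>s \<subseteq> \<Gamma>" "set \<psi>s \<subseteq> \<Gamma>"
    and der: "GL (Imp (Conj \<phi>s) \<phi>)" "GL (Imp (Conj \<psi>s) \<psi>)"
    using assms(1,2) unfolding derivable_def by blast
  from der have "GL (Imp (Conj (\<phi>s @ \<psi>s)) \<chi>)"
    by (rule GL_consequence2) (use assms(3) in auto)
  with sub show ?thesis
    unfolding derivable_def by (intro exI[of _ "\<phi>s @ \<psi>s"]) auto
qed

lemma derivable_consequence:
  assumes "derivable \<Gamma> \<phi>" and "\<And>h. bool_eval h \<phi> \<Longrightarrow> bool_eval h \<psi>"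
  shows "derivable \<Gamma> \<psi>"
  using assms(1,1) by (rule derivable_consequence2) (rule assms(2))

lemma derivable_deduction:
  assumes "derivable (insert \<phi> \<Gamma>) \<psi>"
  shows "derivable \<Gamma> (Imp \<phi> \<psi>)"
proof -
  obtain \<phi>s where \<phi>s: "set \<phi>s \<subseteq> insert \<phi> \<Gamma>" "GL (Imp (Conj \<phi>s) \<psi>)"
    using assms unfolding derivable_def by blast
  have "GL (Imp (Conj (filter (\<lambda>\<chi>. \<chi> \<noteq> \<phi>) \<phi>s)) (Imp \<phi> \<psi>))"
    by (rule GL_consequence[OF \<phi>s(2)]) auto
  then show ?thesis
    using \<phi>s(1) unfolding derivable_def by (intro exI[of _ "filter (\<lambda>\<chi>. \<chi> \<noteq> \<phi>) \<phi>s"]) auto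
qed

lemma derivable_Box:
  assumes "derivable \<Gamma> \<phi>"
  shows "derivable (Box ` \<Gamma>) (Box \<phi>)"
proof -
  obtain \<phi>s where "set \<phi>s \<subseteq> \<Gamma>" "GL (Imp (Conj \<phi>s) \<phi>)"
    using assms unfolding derivable_def by blast
  then show ?thesis
    using GL_Box_Conj unfolding derivable_def by (intro exI[of _ "map Box \<phi>s"]) auto
qed

definition MCS :: "'p fm set \<Rightarrow> bool" where
  "MCS \<Gamma> \<longleftrightarrow> GL_consistent \<Gamma> \<and> (\<forall>\<phi>. \<phi> \<in> \<Gamma> \<or> Neg \<phi> \<in> \<Gamma>)"

lemma MCS_derivable:
  assumes "MCS \<Gamma>" "derivable \<Gamma> \<phi>"
  shows "\<phi> \<in> \<Gamma>"
proof (rule ccontr)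
  assume "\<phi> \<notin> \<Gamma>"
  then have "derivable \<Gamma> (Neg \<phi>)"
    using assms(1) by (auto simp: MCS_def intro: derivable_assumption)
  with assms(2) have "derivable \<Gamma> Bot"
    by (rule derivable_consequence2) auto
  then show False
    using assms(1) by (simp add: MCS_def GL_consistent_iff_not_derivable)
qed

lemma MCS_GL: "MCS \<Gamma> \<Longrightarrow> GL \<phi> \<Longrightarrow> \<phi> \<in> \<Gamma>"
  by (simp add: MCS_derivable derivable_GL)

lemma MCS_consequence2:
  assumes "MCS \<Gamma>" "\<phi> \<in> \<Gamma>" "\<psi> \<in> \<Gamma>"
    and "\<And>h. bool_eval h \<phi> \<Longrightarrow> bool_eval h \<psi> \<Longrightarrow> bool_eval h \<chi>"
  shows "\<chi> \<in> \<Gamma>"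
  using derivable_consequence2[OF assms(2,3)[THEN derivable_assumption] assms(4)]
  by (rule MCS_derivable[OF assms(1)])

lemma MCS_MP: "MCS \<Gamma> \<Longrightarrow> Imp \<phi> \<psi> \<in> \<Gamma> \<Longrightarrow> \<phi> \<in> \<Gamma> \<Longrightarrow> \<psi> \<in> \<Gamma>"
  by (rule MCS_consequence2[of \<Gamma> "Imp \<phi> \<psi>" \<phi>]) auto

lemma MCS_Bot: "MCS \<Gamma> \<Longrightarrow> Bot \<notin> \<Gamma>"
  by (auto simp: MCS_def GL_consistent_iff_not_derivable intro: derivable_assumption)

lemma MCS_Neg:
  assumes "MCS \<Gamma>"
  shows "Neg \<phi> \<in> \<Gamma> \<longleftrightarrow> \<phi> \<notin> \<Gamma>"
proof -
  have "Bot \<in> \<Gamma>" if "Neg \<phi> \<in> \<Gamma>" "\<phi> \<in> \<Gamma>"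
    using assms that by (rule MCS_consequence2) auto
  then show ?thesis
    using assms MCS_Bot by (auto simp: MCS_def)
qed

lemma MCS_Con:
  assumes "MCS \<Gamma>"
  shows "Con \<phi> \<psi> \<in> \<Gamma> \<longleftrightarrow> \<phi> \<in> \<Gamma> \<and> \<psi> \<in> \<Gamma>"
proof (intro iffI conjI)
  show "Con \<phi> \<psi> \<in> \<Gamma>" if "\<phi> \<in> \<Gamma> \<and> \<psi> \<in> \<Gamma>"
    by (rule MCS_consequence2[OF assms, of \<phi> \<psi>]) (use that in auto)
  show "\<phi> \<in> \<Gamma>" "\<psi> \<in> \<Gamma>" if "Con \<phi> \<psi> \<in> \<Gamma>"
    by (rule MCS_consequence2[OF assms that that]; simp)+
qed

lemma MCS_Box_MP: "MCS \<Gamma> \<Longrightarrow> Box (Imp \<phi> \<psi>) \<in> \<Gamma> \<Longrightarrow> Box \<phi> \<in> \<Gamma> \<Longrightarrow> Box \<psi> \<in> \<Gamma>"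
  using MCS_MP MCS_GL[OF _ GL.K] by blast

lemma MCS_Loeb: "MCS \<Gamma> \<Longrightarrow> Box (Imp (Box \<phi>) \<phi>) \<in> \<Gamma> \<Longrightarrow> Box \<phi> \<in> \<Gamma>"
  using MCS_MP MCS_GL[OF _ GL.Loeb] by blast

lemma MCS_4: "MCS \<Gamma> \<Longrightarrow> Box \<phi> \<in> \<Gamma> \<Longrightarrow> Box (Box \<phi>) \<in> \<Gamma>"
  using MCS_MP MCS_GL[OF _ GL_4] by blast

lemma GL_consistent_Union_chain:
  assumes "\<C> \<noteq> {}" "subset.chain {\<Delta>. GL_consistent \<Delta>} \<C>"
  shows "GL_consistent (\<Union>\<C>)"
  unfolding GL_consistent_def
proof clarify
  fix \<phi>s assume \<phi>s: "set \<phi>s \<subseteq> \<Union>\<C>" "GL (Imp (Conj \<phi>s) Bot)"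
  obtain \<Delta> where "\<Delta> \<in> \<C>" "set \<phi>s \<subseteq> \<Delta>"
    using finite_subset_Union_chain[OF finite_set \<phi>s(1) assms] by blast
  then show False
    using \<phi>s(2) assms(2) by (auto simp: subset.chain_def GL_consistent_def)
qed

lemma GL_consistent_insert_cases:
  assumes "GL_consistent \<Gamma>"
  shows "GL_consistent (insert \<phi> \<Gamma>) \<or> GL_consistent (insert (Neg \<phi>) \<Gamma>)"
proof (rule ccontr)
  assume "\<not> ?thesis"
  then have "derivable \<Gamma> (Imp \<phi> Bot)" "derivable \<Gamma> (Imp (Neg \<phi>) Bot)"
    by (auto simp: GL_consistent_iff_not_derivable intro: derivable_deduction)
  then have "derivable \<Gamma> Bot"
    by (rule derivable_consequence2) auto
  then show False
    using assms by (simp add: GL_consistent_iff_not_derivable)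
qed

lemma Lindenbaum:
  assumes "GL_consistent \<Gamma>"
  shows "\<exists>\<Delta>. \<Gamma> \<subseteq> \<Delta> \<and> MCS \<Delta>"
proof -
  let ?A = "{\<Delta>. \<Gamma> \<subseteq> \<Delta> \<and> GL_consistent \<Delta>}"
  have "\<exists>\<Delta>\<in>?A. \<forall>\<Theta>\<in>?A. \<Delta> \<subseteq> \<Theta> \<longrightarrow> \<Theta> = \<Delta>"
  proof (rule subset_Zorn_nonempty)
    show "?A \<noteq> {}"
      using assms by blast
    fix \<C> assume \<C>: "\<C> \<noteq> {}" "subset.chain ?A \<C>"
    then have "GL_consistent (\<Union>\<C>)" "\<Gamma> \<subseteq> \<Union>\<C>"
      by (auto simp: subset.chain_def subset_iff intro!: GL_consistent_Union_chain)
    then show "\<Union>\<C> \<in> ?A"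
      by simp
  qed
  then obtain \<Delta> where \<Delta>: "\<Gamma> \<subseteq> \<Delta>" "GL_consistent \<Delta>"
    and maximal: "\<And>\<Theta>. GL_consistent \<Theta> \<Longrightarrow> \<Delta> \<subseteq> \<Theta> \<Longrightarrow> \<Theta> = \<Delta>"
    by (auto intro: order_trans)
  have "\<phi> \<in> \<Delta> \<or> Neg \<phi> \<in> \<Delta>" for \<phi>
    using GL_consistent_insert_cases[OF \<Delta>(2), of \<phi>] maximal by blast
  then show ?thesis
    using \<Delta> by (auto simp: MCS_def)
qed


section \<open>Accessibility and depth\<close>

definition accessible :: "'p fm set \<Rightarrow> 'p fm set \<Rightarrow> bool" where
  "accessible \<Delta> \<Theta> \<longleftrightarrow> (\<forall>\<chi>. Box \<chi> \<in> \<Delta> \<longrightarrow> \<chi> \<in> \<Theta> \<and> Box \<chi> \<in> \<Theta>)"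

lemma accessibleD: "accessible \<Delta> \<Theta> \<Longrightarrow> Box \<chi> \<in> \<Delta> \<Longrightarrow> \<chi> \<in> \<Theta> \<and> Box \<chi> \<in> \<Theta>"
  by (simp add: accessible_def)

lemma accessible_trans: "accessible \<Delta> \<Theta> \<Longrightarrow> accessible \<Theta> \<Lambda> \<Longrightarrow> accessible \<Delta> \<Lambda>"
  unfolding accessible_def by blast

lemma accessible_refuting_exists:
  assumes "MCS \<Delta>" "Box \<psi> \<notin> \<Delta>"
  shows "\<exists>\<Theta>. MCS \<Theta> \<and> accessible \<Delta> \<Theta> \<and> \<psi> \<notin> \<Theta> \<and> Box \<psi> \<in> \<Theta>"
proof -
  define D where "D = {\<chi>. Box \<chi> \<in> \<Delta>} \<union> Box ` {\<chi>. Box \<chi> \<in> \<Delta>}"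
  let ?S = "insert (Neg \<psi>) (insert (Box \<psi>) D)"
  have "Box ` D \<subseteq> \<Delta>"
    using MCS_4[OF assms(1)] by (auto simp: D_def)
  have "GL_consistent ?S"
    unfolding GL_consistent_iff_not_derivable
  proof
    assume "derivable ?S Bot"
    then have "derivable D (Imp (Box \<psi>) (Imp (Neg \<psi>) Bot))"
      by (intro derivable_deduction)
    then have "derivable D (Imp (Box \<psi>) \<psi>)"
      by (rule derivable_consequence) auto
    then have "Box (Imp (Box \<psi>) \<psi>) \<in> \<Delta>"
      using derivable_mono[OF derivable_Box \<open>Box ` D \<subseteq> \<Delta>\<close>] MCS_derivable[OF assms(1)] by blast
    then show False
      using MCS_Loeb[OF assms(1)] assms(2) by blast
  qed
  then obtain \<Theta> where "?S \<subseteq> \<Theta>" "MCS \<Theta>"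
    using Lindenbaum by blast
  then show ?thesis
    unfolding accessible_def D_def by (intro exI[of _ \<Theta>]) (auto simp: MCS_Neg)
qed

abbreviation Box_power_Bot :: "nat \<Rightarrow> 'p fm" where
  "Box_power_Bot k \<equiv> (Box ^^ k) Bot"

definition depth :: "'p fm set \<Rightarrow> enat" where
  "depth \<Delta> = (INF k\<in>{k. Box_power_Bot k \<in> \<Delta>}. enat k)"

lemma GL_Box_power_Bot_Suc: "GL (Imp (Box_power_Bot k) (Box_power_Bot (Suc k)))"
  by (induction k) (auto intro: GL.taut GL_Box_mono simp: tautology_def)

lemma MCS_Box_power_Bot_mono:
  assumes "MCS \<Delta>" "j \<le> k" "Box_power_Bot j \<in> \<Delta>"
  shows "Box_power_Bot k \<in> \<Delta>"
  using assms(2)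
  by (induction k rule: dec_induct)
    (fact assms(3), use MCS_MP[OF assms(1) MCS_GL[OF assms(1) GL_Box_power_Bot_Suc]] in blast)

lemma depth_le_iff:
  assumes "MCS \<Delta>"
  shows "depth \<Delta> \<le> enat k \<longleftrightarrow> Box_power_Bot k \<in> \<Delta>"
proof
  assume "depth \<Delta> \<le> enat k"
  then have "depth \<Delta> < enat (Suc k)"
    by (simp add: order_le_less_trans)
  then obtain j where "Box_power_Bot j \<in> \<Delta>" "j \<le> k"
    by (auto simp: depth_def INF_less_iff)
  then show "Box_power_Bot k \<in> \<Delta>"
    using MCS_Box_power_Bot_mono[OF assms] by blast
qed (auto simp: depth_def intro: INF_lower)

lemma less_depth_iff: "MCS \<Delta> \<Longrightarrow> enat k < depth \<Delta> \<longleftrightarrow> Box_power_Bot k \<notin> \<Delta>"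
  using depth_le_iff not_le by blast

lemma finite_depth_eq_Suc:
  assumes "MCS \<Delta>" "depth \<Delta> < \<infinity>"
  obtains k where "depth \<Delta> = enat (Suc k)"
proof -
  have "depth \<Delta> \<noteq> enat 0"
    using depth_le_iff[OF assms(1), of 0] MCS_Bot[OF assms(1)] by auto
  then show ?thesis
    using assms(2) that by (metis enat_ord_simps(4) not_infinity_eq not0_implies_Suc)
qed

lemma depth_less_if_accessible:
  assumes "MCS \<Delta>" "MCS \<Theta>" "accessible \<Delta> \<Theta>" "depth \<Delta> < \<infinity>"
  shows "depth \<Theta> < depth \<Delta>"
proof -
  obtain k where k: "depth \<Delta> = enat (Suc k)"
    using finite_depth_eq_Suc[OF assms(1,4)] .
  then have "Box (Box_power_Bot k) \<in> \<Delta>"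
    using depth_le_iff[OF assms(1), of "Suc k"] by simp
  then have "depth \<Theta> \<le> enat k"
    using accessibleD[OF assms(3)] depth_le_iff[OF assms(2)] by blast
  then show ?thesis
    unfolding k by (rule order_le_less_trans) simp
qed


section \<open>Approximation by maximal consistent sets of finite depth\<close>

definition is_root_of :: "'p fm set \<Rightarrow> 'p fm set set \<Rightarrow> bool" where
  "is_root_of \<Delta> \<T> \<longleftrightarrow> (\<forall>\<chi>. Box \<chi> \<in> \<Delta> \<longleftrightarrow> (\<forall>\<Theta>\<in>\<T>. \<chi> \<in> \<Theta> \<and> Box \<chi> \<in> \<Theta>))"

lemma bool_eval_GL_root:
  assumes mcs: "\<And>\<Theta>. \<Theta> \<in> \<T> \<Longrightarrow> MCS \<Theta>"
    and root: "\<And>\<chi>. h (Box \<chi>) \<longleftrightarrow> (\<forall>\<Theta>\<in>\<T>. \<chi> \<in> \<Theta> \<and> Box \<chi> \<in> \<Theta>)"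
    and "GL \<phi>"
  shows "bool_eval h \<phi>"
  using assms(3)
proof (induction rule: GL.induct)
  case (taut \<phi>)
  then show ?case
    by (simp add: tautology_def)
next
  case (K \<phi> \<psi>)
  have "\<psi> \<in> \<Theta> \<and> Box \<psi> \<in> \<Theta>"
    if "\<Theta> \<in> \<T>" "Imp \<phi> \<psi> \<in> \<Theta> \<and> Box (Imp \<phi> \<psi>) \<in> \<Theta>" "\<phi> \<in> \<Theta> \<and> Box \<phi> \<in> \<Theta>" for \<Theta>
    using that MCS_MP[OF mcs] MCS_Box_MP[OF mcs] by blast
  then show ?case
    by (auto simp: root)
next
  case (Loeb \<phi>)
  have "\<phi> \<in> \<Theta> \<and> Box \<phi> \<in> \<Theta>"
    if "\<Theta> \<in> \<T>" "Imp (Box \<phi>) \<phi> \<in> \<Theta> \<and> Box (Imp (Box \<phi>) \<phi>) \<in> \<Theta>" for \<Theta>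
    using that MCS_MP[OF mcs] MCS_Loeb[OF mcs] by blast
  then show ?case
    by (auto simp: root)
next
  case (MP \<phi> \<psi>)
  then show ?case
    by simp
next
  case (Nec \<phi>)
  then show ?case
    using MCS_GL[OF mcs] by (auto simp: root intro: GL.Nec)
qed

lemma MCS_root_exists:
  assumes "\<And>\<Theta>. \<Theta> \<in> \<T> \<Longrightarrow> MCS \<Theta>"
  shows "\<exists>\<Delta>. MCS \<Delta> \<and> is_root_of \<Delta> \<T> \<and> (\<forall>p. Var p \<in> \<Delta> \<longleftrightarrow> p \<in> P)"
proof -
  define h where "h \<phi> = (case \<phi> of Var p \<Rightarrow> p \<in> P
    | Box \<chi> \<Rightarrow> \<forall>\<Theta>\<in>\<T>. \<chi> \<in> \<Theta> \<and> Box \<chi> \<in> \<Theta> | _ \<Rightarrow> False)" for \<phi>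
  have sound: "bool_eval h \<phi>" if "GL \<phi>" for \<phi>
    using assms _ that by (rule bool_eval_GL_root) (simp_all add: h_def)
  have "MCS {\<phi>. bool_eval h \<phi>}"
    by (auto simp: MCS_def GL_consistent_def dest!: sound)
  moreover have "is_root_of {\<phi>. bool_eval h \<phi>} \<T>"
    by (simp add: is_root_of_def h_def)
  moreover have "Var p \<in> {\<phi>. bool_eval h \<phi>} \<longleftrightarrow> p \<in> P" for p
    by (simp add: h_def)
  ultimately show ?thesis
    by blast
qed

lemma finite_depth_root:
  assumes "MCS \<Delta>" "is_root_of \<Delta> \<T>" "finite \<T>"
    and "\<And>\<Theta>. \<Theta> \<in> \<T> \<Longrightarrow> MCS \<Theta> \<and> depth \<Theta> < \<infinity>"
  shows "depth \<Delta> < \<infinity>"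
proof -
  have "\<exists>k. \<forall>\<Theta>\<in>\<T>. depth \<Theta> \<le> enat k"
    using assms(3,4)
  proof (induction \<T>)
    case (insert \<Theta> \<T>)
    then obtain j k where "depth \<Theta> = enat j" "\<forall>\<Lambda>\<in>\<T>. depth \<Lambda> \<le> enat k"
      by (metis enat_ord_simps(4) insertCI not_infinity_eq)
    then show ?case
      by (intro exI[of _ "max j k"]) (auto intro: order_trans)
  qed simp
  then obtain k where "\<forall>\<Theta>\<in>\<T>. Box_power_Bot k \<in> \<Theta>"
    using depth_le_iff assms(4) by blast
  then have "Box_power_Bot (Suc k) \<in> \<Theta>" "Box_power_Bot k \<in> \<Theta>" if "\<Theta> \<in> \<T>" for \<Theta>
    using MCS_Box_power_Bot_mono[of \<Theta> k "Suc k"] assms(4) that by auto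
  then have "Box_power_Bot (Suc k) \<in> \<Delta>"
    using assms(2) by (simp add: is_root_of_def)
  then have "depth \<Delta> \<le> enat (Suc k)"
    using depth_le_iff[OF assms(1)] by blast
  then show ?thesis
    by (rule order_le_less_trans) simp
qed

definition sub_closed :: "'p fm set \<Rightarrow> bool" where
  "sub_closed F \<longleftrightarrow> (\<forall>\<phi>. Neg \<phi> \<in> F \<longrightarrow> \<phi> \<in> F) \<and> (\<forall>\<phi> \<psi>. Con \<phi> \<psi> \<in> F \<longrightarrow> \<phi> \<in> F \<and> \<psi> \<in> F) \<and>
     (\<forall>\<phi>. Box \<phi> \<in> F \<longrightarrow> \<phi> \<in> F)"

primrec subfm :: "'p fm \<Rightarrow> 'p fm set" where
  "subfm (Var p) = {Var p}"
| "subfm Bot = {Bot}"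
| "subfm (Neg \<phi>) = insert (Neg \<phi>) (subfm \<phi>)"
| "subfm (Con \<phi> \<psi>) = insert (Con \<phi> \<psi>) (subfm \<phi> \<union> subfm \<psi>)"
| "subfm (Box \<phi>) = insert (Box \<phi>) (subfm \<phi>)"

lemma finite_subfm: "finite (subfm \<phi>)"
  by (induction \<phi>) auto

lemma subfm_refl: "\<phi> \<in> subfm \<phi>"
  by (cases \<phi>) auto

lemma subfm_trans: "\<psi> \<in> subfm \<phi> \<Longrightarrow> subfm \<psi> \<subseteq> subfm \<phi>"
  by (induction \<phi>) auto

lemma sub_closed_subfm: "sub_closed (subfm \<phi>)"
  unfolding sub_closed_def using subfm_trans[of _ \<phi>] subfm_refl by fastforce

lemma finite_sub_closed_superset_exists:
  assumes "finite G"
  shows "\<exists>F. finite F \<and> sub_closed F \<and> G \<subseteq> F"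
proof (intro exI conjI)
  show "finite (\<Union>\<phi>\<in>G. subfm \<phi>)"
    using assms by (simp add: finite_subfm)
  show "sub_closed (\<Union>\<phi>\<in>G. subfm \<phi>)"
    using sub_closed_subfm unfolding sub_closed_def by blast
  show "G \<subseteq> (\<Union>\<phi>\<in>G. subfm \<phi>)"
    by (auto intro: subfm_refl)
qed

lemma MCS_agree_on_sub_closed:
  assumes "MCS \<Delta>" "MCS \<Theta>" "sub_closed F"
    and "\<And>p. Var p \<in> F \<Longrightarrow> Var p \<in> \<Delta> \<longleftrightarrow> Var p \<in> \<Theta>"
    and "\<And>\<chi>. Box \<chi> \<in> F \<Longrightarrow> Box \<chi> \<in> \<Delta> \<longleftrightarrow> Box \<chi> \<in> \<Theta>"
  shows "\<phi> \<in> F \<Longrightarrow> \<phi> \<in> \<Delta> \<longleftrightarrow> \<phi> \<in> \<Theta>"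
proof (induction \<phi>)
  case (Neg \<phi>)
  then have "\<phi> \<in> F"
    using assms(3) unfolding sub_closed_def by blast
  with Neg.IH show ?case
    by (simp add: MCS_Neg assms(1,2))
next
  case (Con \<phi> \<psi>)
  then have "\<phi> \<in> F" "\<psi> \<in> F"
    using assms(3) unfolding sub_closed_def by blast+
  with Con.IH show ?case
    by (simp add: MCS_Con assms(1,2))
qed (use assms(4,5) MCS_Bot[OF assms(1)] MCS_Bot[OF assms(2)] in auto)

definition finite_depth_approximant :: "'p fm set \<Rightarrow> 'p fm set \<Rightarrow> 'p fm set \<Rightarrow> bool" where
  "finite_depth_approximant F \<Delta> \<Theta> \<longleftrightarrow>
     MCS \<Theta> \<and> depth \<Theta> < \<infinity> \<and> (\<forall>\<phi>\<in>F. \<phi> \<in> \<Theta> \<longleftrightarrow> \<phi> \<in> \<Delta>)"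

lemma finite_missing_boxes: "finite F \<Longrightarrow> finite {\<psi>. Box \<psi> \<in> F - \<Delta>}"
  using finite_vimageI[of "F - \<Delta>" Box] by (simp add: vimage_def inj_def)

lemma finite_depth_approximant_if_refuted:
  assumes "finite F" "sub_closed F" "MCS \<Delta>"
    and refuted: "\<And>\<psi>. Box \<psi> \<in> F - \<Delta> \<Longrightarrow> \<exists>\<Theta>. MCS \<Theta> \<and> depth \<Theta> < \<infinity> \<and> \<psi> \<notin> \<Theta> \<and>
      (\<forall>\<chi>. Box \<chi> \<in> F \<inter> \<Delta> \<longrightarrow> \<chi> \<in> \<Theta> \<and> Box \<chi> \<in> \<Theta>)"
  shows "\<exists>\<Theta>. finite_depth_approximant F \<Delta> \<Theta>"
proof -
  let ?missing = "{\<psi>. Box \<psi> \<in> F - \<Delta>}"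
  obtain t where t: "\<And>\<psi>. \<psi> \<in> ?missing \<Longrightarrow> MCS (t \<psi>) \<and> depth (t \<psi>) < \<infinity> \<and> \<psi> \<notin> t \<psi> \<and>
      (\<forall>\<chi>. Box \<chi> \<in> F \<inter> \<Delta> \<longrightarrow> \<chi> \<in> t \<psi> \<and> Box \<chi> \<in> t \<psi>)"
    using refuted unfolding mem_Collect_eq by metis
  obtain \<Theta> where \<Theta>: "MCS \<Theta>" "is_root_of \<Theta> (t ` ?missing)" "\<And>p. Var p \<in> \<Theta> \<longleftrightarrow> Var p \<in> \<Delta>"
    using MCS_root_exists[of "t ` ?missing" "{p. Var p \<in> \<Delta>}"] t by auto
  have "depth \<Theta> < \<infinity>"
    using \<Theta>(1,2) by (rule finite_depth_root) (use finite_missing_boxes[OF assms(1)] t in auto)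
  moreover have "Box \<chi> \<in> \<Theta> \<longleftrightarrow> Box \<chi> \<in> \<Delta>" if "Box \<chi> \<in> F" for \<chi>
    using \<Theta>(2) t that unfolding is_root_of_def by blast
  then have "\<forall>\<phi>\<in>F. \<phi> \<in> \<Theta> \<longleftrightarrow> \<phi> \<in> \<Delta>"
    using MCS_agree_on_sub_closed[OF \<Theta>(1) assms(3,2)] \<Theta>(3) by blast
  ultimately show ?thesis
    using \<Theta>(1) unfolding finite_depth_approximant_def by blast
qed

lemma finite_depth_approximant_exists_sub_closed:
  assumes "finite F" "sub_closed F" "MCS \<Delta>"
  shows "\<exists>\<Theta>. finite_depth_approximant F \<Delta> \<Theta>"
  using assms(3)
proof (induction "card {\<psi>. Box \<psi> \<in> F - \<Delta>}" arbitrary: \<Delta> rule: less_induct)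
  case less
  let ?missing = "\<lambda>\<Delta>. {\<psi>. Box \<psi> \<in> F - \<Delta>}"
  show ?case
  proof (rule finite_depth_approximant_if_refuted[OF assms(1,2) less.prems])
    fix \<psi> assume \<psi>: "Box \<psi> \<in> F - \<Delta>"
    then obtain \<Lambda> where \<Lambda>: "MCS \<Lambda>" "accessible \<Delta> \<Lambda>" "\<psi> \<notin> \<Lambda>" "Box \<psi> \<in> \<Lambda>"
      using accessible_refuting_exists[OF less.prems] by blast
    have "?missing \<Lambda> \<subset> ?missing \<Delta>"
      using \<psi> \<Lambda>(4) accessibleD[OF \<Lambda>(2)] by blast
    then have "card (?missing \<Lambda>) < card (?missing \<Delta>)"
      by (rule psubset_card_mono[OF finite_missing_boxes[OF assms(1)]])
    then obtain \<Theta> where \<Theta>: "finite_depth_approximant F \<Lambda> \<Theta>"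
      using less.hyps \<Lambda>(1) by blast
    have "\<chi> \<in> F" if "Box \<chi> \<in> F" for \<chi>
      using assms(2) that unfolding sub_closed_def by blast
    then show "\<exists>\<Theta>. MCS \<Theta> \<and> depth \<Theta> < \<infinity> \<and> \<psi> \<notin> \<Theta> \<and>
        (\<forall>\<chi>. Box \<chi> \<in> F \<inter> \<Delta> \<longrightarrow> \<chi> \<in> \<Theta> \<and> Box \<chi> \<in> \<Theta>)"
      using \<psi> \<Theta> \<Lambda>(3) accessibleD[OF \<Lambda>(2)]
      by (intro exI[of _ \<Theta>]) (auto simp: finite_depth_approximant_def)
  qed
qed

lemma finite_depth_approximant_exists:
  assumes "MCS \<Delta>" "finite G"
  shows "\<exists>\<Theta>. finite_depth_approximant G \<Delta> \<Theta>"
proof -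
  obtain F where "finite F" "sub_closed F" "G \<subseteq> F"
    using finite_sub_closed_superset_exists[OF assms(2)] by blast
  moreover from this obtain \<Theta> where "finite_depth_approximant F \<Delta> \<Theta>"
    using finite_depth_approximant_exists_sub_closed[OF _ _ assms(1)] by blast
  ultimately have "finite_depth_approximant G \<Delta> \<Theta>"
    unfolding finite_depth_approximant_def by blast
  then show ?thesis ..
qed

text \<open>
  A set of infinite depth need not have accessible sets of finite depth, so accessibility from it
  is replaced by an approximation, on the formulae with codes below a given \<open>n\<close>.
\<close>

definition descends :: "'p fm set \<Rightarrow> 'p fm set \<Rightarrow> bool" where
  "descends \<Delta> \<Theta> \<longleftrightarrow> depth \<Theta> < depth \<Delta> \<and> (depth \<Delta> < \<infinity> \<longrightarrow> accessible \<Delta> \<Theta>)"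

lemma descends_trans:
  assumes "descends \<Delta> \<Theta>" "descends \<Theta> \<Lambda>"
  shows "descends \<Delta> \<Lambda>"
  using assms accessible_trans[of \<Delta> \<Theta> \<Lambda>] unfolding descends_def
  by (metis order_less_trans)

instance fm :: (countable) countable
  by countable_datatype

definition approx_successor ::
    "nat \<Rightarrow> 'p::countable fm set \<Rightarrow> 'p fm \<Rightarrow> 'p fm set \<Rightarrow> bool" where
  "approx_successor n \<Delta> \<psi> \<Theta> \<longleftrightarrow> MCS \<Theta> \<and> \<psi> \<notin> \<Theta> \<and> descends \<Delta> \<Theta> \<and>
     (\<forall>\<chi>. to_nat \<chi> < n \<and> Box \<chi> \<in> \<Delta> \<longrightarrow> \<chi> \<in> \<Theta> \<and> Box \<chi> \<in> \<Theta>)"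

lemma approx_successor_exists:
  fixes \<Delta> :: "'p::countable fm set"
  assumes "MCS \<Delta>" "Box \<psi> \<notin> \<Delta>"
  shows "\<exists>\<Theta>. approx_successor n \<Delta> \<psi> \<Theta>"
proof -
  obtain \<Lambda> where \<Lambda>: "MCS \<Lambda>" "accessible \<Delta> \<Lambda>" "\<psi> \<notin> \<Lambda>"
    using accessible_refuting_exists[OF assms] by blast
  show ?thesis
  proof (cases "depth \<Delta> < \<infinity>")
    case True
    then have "approx_successor n \<Delta> \<psi> \<Lambda>"
      using \<Lambda> accessibleD depth_less_if_accessible[OF assms(1)]
      by (auto simp: approx_successor_def descends_def)
    then show ?thesis ..
  next
    case False
    let ?C = "{\<chi>. to_nat \<chi> < n} :: 'p fm set"
    have "finite ?C"
      using finite_vimageI[of "{..<n}" "to_nat :: 'p fm \<Rightarrow> nat"] by (simp add: vimage_def)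
    then have "finite (insert \<psi> (?C \<union> Box ` ?C))"
      by simp
    from finite_depth_approximant_exists[OF \<Lambda>(1) this] obtain \<Theta>
      where "finite_depth_approximant (insert \<psi> (?C \<union> Box ` ?C)) \<Lambda> \<Theta>" ..
    then have "approx_successor n \<Delta> \<psi> \<Theta>"
      using \<Lambda>(3) accessibleD[OF \<Lambda>(2)] False
      by (auto simp: finite_depth_approximant_def approx_successor_def descends_def)
    then show ?thesis ..
  qed
qed


section \<open>Ranks and neighbourhoods in bouquets\<close>

lemma mem_derived_cb_seq_iff:
  assumes "\<exists>\<alpha>::cord. x \<notin> X derived_set_of (cb_seq X \<alpha>)"
  shows "x \<in> X derived_set_of (cb_seq X \<beta>) \<longleftrightarrow> \<beta> < cb_rank X x"
proof
  assume x: "x \<in> X derived_set_of (cb_seq X \<beta>)"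
  have "x \<notin> X derived_set_of (cb_seq X (cb_rank X x))"
    unfolding cb_rank_def using assms by (rule LeastI_ex)
  then show "\<beta> < cb_rank X x"
    using x derived_set_of_mono[OF cb_seq_antimono] by (metis not_le subsetD)
next
  assume "\<beta> < cb_rank X x"
  then show "x \<in> X derived_set_of (cb_seq X \<beta>)"
    unfolding cb_rank_def using not_less_Least by blast
qed

lemma mem_cb_seq_iff:
  assumes "\<exists>\<alpha>::cord. x \<notin> X derived_set_of (cb_seq X \<alpha>)"
  shows "x \<in> cb_seq X \<beta> \<longleftrightarrow> x \<in> topspace X \<and> \<beta> \<le> cb_rank X x"
  unfolding cb_seq.simps[of X \<beta>] using mem_derived_cb_seq_iff[OF assms] leI
  by (fastforce intro: order_less_le_trans)

lemma daughters_subset: "daughters R w \<subseteq> R `` {w}"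
  by (auto simp: daughters_def)

abbreviation cone :: "'a rel \<Rightarrow> 'a \<Rightarrow> 'a set" where
  "cone R v \<equiv> {v} \<union> R `` {v}"

lemma daughters_minus_upward_closed: "R `` {w} \<subseteq> U \<Longrightarrow> daughters R w - U = {}"
  using daughters_subset[of R w] by blast

lemma finite_daughters_minus_basic_neighbourhood:
  fixes v :: "nat \<Rightarrow> 'a"
  assumes "trans R" "bij_betw v UNIV (daughters R c)" "w \<in> {c} \<union> (\<Union>i\<in>{n<..}. cone R (v i))"
  shows "finite (daughters R w - ({c} \<union> (\<Union>i\<in>{n<..}. cone R (v i))))" (is "finite (_ - ?U)")
proof (cases "w = c")
  case True
  have "daughters R w - ?U \<subseteq> v ` {..n}"
    using assms(2) unfolding True bij_betw_def by (force simp: not_le)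
  then show ?thesis
    using finite_subset by blast
next
  case False
  then obtain i where "n < i" "w \<in> cone R (v i)"
    using assms(3) by blast
  then have "R `` {w} \<subseteq> ?U"
    using transD[OF assms(1)] by blast
  then show ?thesis
    by (simp only: daughters_minus_upward_closed finite.emptyI)
qed

lemma bouquet_neighbourhood_cofinite:
  assumes "trans R" "openin (bouquet_topology T R) U" "w \<in> U"
  shows "finite (daughters R w - U)"
  using assms(2,3) unfolding bouquet_topology_def openin_topology_generated_by_iff
proof (induction U rule: generate_topology_on.induct)
  case (Int U V)
  then show ?case
    by (simp add: Diff_Int)
next
  case (UN K)
  then obtain U where "U \<in> K" "w \<in> U" "finite (daughters R w - U)"
    by blast
  then show ?case
    using rev_finite_subset[of "daughters R w - U" "daughters R w - \<Union>K"] by blast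
next
  case (Basis U)
  from Basis.hyps consider (upset) "openin (upset_topology T R) U"
    | (limit) c n and v :: "nat \<Rightarrow> 'a" where "bij_betw v UNIV (daughters R c)"
        "U = {c} \<union> (\<Union>i\<in>{n<..}. cone R (v i))"
    by blast
  then show ?case
  proof cases
    case upset
    then have "R `` {w} \<subseteq> U"
      using Basis.prems by (auto simp: openin_upset_topology)
    then show ?thesis
      by (simp only: daughters_minus_upward_closed finite.emptyI)
  next
    case limit
    then show ?thesis
      using finite_daughters_minus_basic_neighbourhood[OF assms(1)] Basis.prems by blast
  qed
qed simp

lemma openin_bouquet_upset:
  "openin (upset_topology T R) U \<Longrightarrow> openin (bouquet_topology T R) U"
  unfolding bouquet_topology_def openin_topology_generated_by_iff
  by (intro generate_topology_on.Basis) blast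

locale strict_frame =
  fixes T :: "'a set" and R :: "'a rel"
  assumes R_subset: "R \<subseteq> T \<times> T" and trans_R: "trans R" and irrefl_R: "irrefl R"
begin

abbreviation rank :: "'a \<Rightarrow> cord" where
  "rank \<equiv> cb_rank (upset_topology T R)"

lemma R_mem: "(w, v) \<in> R \<Longrightarrow> w \<in> T \<and> v \<in> T"
  using R_subset by blast

lemma R_irrefl: "(w, w) \<notin> R"
  using irrefl_R by (simp add: irrefl_def)

lemma topspace_upset: "topspace (upset_topology T R) = T"
proof
  show "topspace (upset_topology T R) \<subseteq> T"
    using openin_topspace[of "upset_topology T R"] unfolding openin_upset_topology by blast
  show "T \<subseteq> topspace (upset_topology T R)"
    using R_mem by (intro openin_subset) (auto simp: openin_upset_topology)
qed

lemma openin_upset_cone: "w \<in> T \<Longrightarrow> openin (upset_topology T R) (cone R w)"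
  using R_mem transD[OF trans_R] by (auto simp: openin_upset_topology)

lemma derived_set_of_upset:
  "w \<in> upset_topology T R derived_set_of A \<longleftrightarrow> (\<exists>v\<in>A. (w, v) \<in> R)"
proof
  assume w: "w \<in> upset_topology T R derived_set_of A"
  then have "w \<in> T"
    by (simp add: in_derived_set_of topspace_upset)
  with w show "\<exists>v\<in>A. (w, v) \<in> R"
    using openin_upset_cone unfolding in_derived_set_of by blast
next
  assume "\<exists>v\<in>A. (w, v) \<in> R"
  then show "w \<in> upset_topology T R derived_set_of A"
    using R_irrefl R_mem unfolding in_derived_set_of topspace_upset openin_upset_topology by metis
qed

lemma openin_bouquet_limit:
  assumes "w \<in> T" "limit_ordinal (rank w)" "countable (daughters R w)" "infinite (daughters R w)"
    and "finite D"
  shows "openin (bouquet_topology T R) ({w} \<union> (\<Union>v\<in>daughters R w - D. cone R v))"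
    (is "openin ?X ({w} \<union> ?U)")
proof -
  obtain v :: "nat \<Rightarrow> 'a" where v: "bij_betw v UNIV (daughters R w)"
    using bij_betw_from_nat_into[OF assms(3,4)] by blast
  have "finite (v -` D)"
    using v assms(5) by (intro finite_vimageI) (auto simp: bij_betw_def)
  then obtain n where n: "\<And>i. v i \<in> D \<Longrightarrow> i \<le> n"
    using finite_nat_set_iff_bounded_le[of "v -` D"] by auto
  let ?V = "{w} \<union> (\<Union>i\<in>{n<..}. cone R (v i))"
  have "openin ?X ?V"
    unfolding bouquet_topology_def openin_topology_generated_by_iff
    using assms(1,2) v by (intro generate_topology_on.Basis) blast
  moreover have "v \<in> T" if "v \<in> daughters R w" for v
    using that daughters_subset[of R w] R_mem by blast
  then have "openin (upset_topology T R) ?U"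
    using openin_upset_cone by (intro openin_Union) auto
  then have "openin ?X ?U"
    by (rule openin_bouquet_upset)
  moreover have "v i \<in> daughters R w - D" if "n < i" for i
    using v n[of i] that unfolding bij_betw_def by auto
  then have "{w} \<union> ?U = ?V \<union> ?U"
    by blast
  ultimately show ?thesis
    by (simp only: openin_Un)
qed

end

locale countable_cwf_tree =
  fixes T :: "'a set" and R :: "'a rel"
  assumes countable_T: "countable T" and tree_TR: "tree T R" and wf_converse: "wf (R\<inverse>)"
begin

sublocale strict_frame T R
  using tree_TR by unfold_locales (simp_all add: tree_def)

lemma countable_daughters: "countable (daughters R w)"
  using daughters_subset[of R w] R_mem by (intro countable_subset[OF _ countable_T]) blast

lemma less_rank_iff: "\<beta> < rank w \<longleftrightarrow> (\<exists>v. (w, v) \<in> R \<and> \<beta> \<le> rank v)"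
proof -
  let ?X = "upset_topology T R"
  note rank_exists = cb_rank_exists[OF countable_T tree_TR wf_converse]
  have "\<beta> < rank w \<longleftrightarrow> w \<in> ?X derived_set_of (cb_seq ?X \<beta>)"
    by (rule mem_derived_cb_seq_iff[OF rank_exists, symmetric])
  also have "\<dots> \<longleftrightarrow> (\<exists>v\<in>cb_seq ?X \<beta>. (w, v) \<in> R)"
    by (rule derived_set_of_upset)
  also have "\<dots> \<longleftrightarrow> (\<exists>v. (w, v) \<in> R \<and> \<beta> \<le> rank v)"
    using R_mem by (auto simp: mem_cb_seq_iff[OF rank_exists] topspace_upset)
  finally show ?thesis .
qed

end


section \<open>Truth in bouquets of maximal consistent sets\<close>

locale canonical_bouquet =
  fixes T :: "'a set" and R :: "'a rel" and lab :: "'a \<Rightarrow> 'p fm set"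
  assumes countable_nodes: "countable T" and tree_nodes: "tree T R"
    and MCS_lab: "w \<in> T \<Longrightarrow> MCS (lab w)"
    and descends_lab: "(w, v) \<in> R \<Longrightarrow> descends (lab w) (lab v)"
    and finite_inaccurate_daughters: "w \<in> T \<Longrightarrow> Box \<phi> \<in> lab w \<Longrightarrow>
      finite {v \<in> daughters R w. \<not> (\<phi> \<in> lab v \<and> Box \<phi> \<in> lab v)}"
    and infinite_refuting_daughters: "w \<in> T \<Longrightarrow> Box \<phi> \<notin> lab w \<Longrightarrow>
      infinite {v \<in> daughters R w. \<phi> \<notin> lab v}"
begin

lemma depth_less: "(w, v) \<in> R \<Longrightarrow> depth (lab v) < depth (lab w)"
  using descends_lab by (simp add: descends_def)

sublocale countable_cwf_tree T R
proof
  have "R\<inverse> \<subseteq> inv_image {(m, n). m < n} (\<lambda>w. depth (lab w))"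
    using depth_less by auto
  then show "wf (R\<inverse>)"
    by (rule wf_subset[OF wf_inv_image[OF wf]])
qed (fact countable_nodes tree_nodes)+

lemma refuting_daughterE:
  assumes "w \<in> T" "Box \<phi> \<notin> lab w"
  obtains v where "(w, v) \<in> R" "v \<in> T" "\<phi> \<notin> lab v"
  using infinite_imp_nonempty[OF infinite_refuting_daughters[OF assms]]
    daughters_subset[of R w] R_mem by blast

lemma rank_less_if_depth_less:
  assumes "u \<in> T" "w \<in> T" "depth (lab u) < depth (lab w)"
  shows "rank u < rank w"
  using wf_converse assms
proof (induction u arbitrary: w rule: wf_induct_rule)
  case (less u)
  have "depth (lab u) < \<infinity>"
    using less.prems(3) by (rule order_less_le_trans) simp
  then obtain k where k: "depth (lab u) = enat (Suc k)"
    using finite_depth_eq_Suc[OF MCS_lab[OF less.prems(1)]] by blast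
  then have "Box (Box_power_Bot k) \<notin> lab w"
    using less.prems(3) less_depth_iff[OF MCS_lab[OF less.prems(2)], of "Suc k"] by simp
  then obtain v where v: "(w, v) \<in> R" "v \<in> T" "Box_power_Bot k \<notin> lab v"
    using refuting_daughterE[OF less.prems(2)] by blast
  have "rank x < rank v" if x: "(u, x) \<in> R" for x
  proof (rule less.IH)
    have "depth (lab x) \<le> enat k"
      using depth_less[OF x] unfolding k by (cases "depth (lab x)") auto
    also have "\<dots> < depth (lab v)"
      using v(3) less_depth_iff[OF MCS_lab[OF v(2)]] by blast
    finally show "depth (lab x) < depth (lab v)" .
  qed (use x v(2) R_mem in auto)
  then have "rank u \<le> rank v"
    using less_rank_iff[of "rank v" u] by (meson not_le)
  then show ?case
    using v(1) less_rank_iff by blast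
qed

lemma limit_rank_if_infinite_depth:
  assumes "w \<in> T" "depth (lab w) = \<infinity>"
  shows "limit_ordinal (rank w)"
  unfolding limit_ordinal_def
proof (intro conjI allI impI)
  have Box_power_Bot: "Box (Box_power_Bot k) \<notin> lab w" for k
    using assms(2) less_depth_iff[OF MCS_lab[OF assms(1)], of "Suc k"] by simp
  show "\<exists>\<beta>. \<beta> < rank w"
    using refuting_daughterE[OF assms(1) Box_power_Bot[of 0]] less_rank_iff by blast
  fix \<beta> assume "\<beta> < rank w"
  then obtain u where u: "(w, u) \<in> R" "\<beta> \<le> rank u"
    unfolding less_rank_iff by blast
  then obtain k where k: "depth (lab u) = enat k"
    using depth_less[OF u(1)] assms(2) by auto
  obtain v where v: "(w, v) \<in> R" "v \<in> T" "Box_power_Bot k \<notin> lab v"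
    using refuting_daughterE[OF assms(1) Box_power_Bot] by blast
  have "depth (lab u) < depth (lab v)"
    unfolding k using v(3) less_depth_iff[OF MCS_lab[OF v(2)]] by blast
  then have "rank u < rank v"
    using u(1) v(2) R_mem by (intro rank_less_if_depth_less) auto
  then show "\<exists>\<gamma>>\<beta>. \<gamma> < rank w"
    using u(2) v(1) less_rank_iff by (meson order_le_less_trans order_refl)
qed

lemma Box_neighbourhood_exists:
  assumes "w \<in> T" "Box \<phi> \<in> lab w"
  shows "\<exists>U. openin (bouquet_topology T R) U \<and> w \<in> U \<and> (\<forall>u\<in>U - {w}. \<phi> \<in> lab u)"
proof (cases "depth (lab w) < \<infinity>")
  case True
  then have "\<phi> \<in> lab v" if "(w, v) \<in> R" for v
    using descends_lab[OF that] assms(2) accessibleD unfolding descends_def by blast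
  then show ?thesis
    using openin_bouquet_upset[OF openin_upset_cone[OF assms(1)]]
    by (intro exI[of _ "cone R w"]) auto
next
  case False
  then have infinite_depth: "depth (lab w) = \<infinity>"
    by simp
  then have "Box_power_Bot 1 \<notin> lab w"
    using less_depth_iff[OF MCS_lab[OF assms(1)], of 1] by simp
  then have "infinite (daughters R w)"
    using infinite_refuting_daughters[OF assms(1), of Bot] rev_finite_subset by fastforce
  let ?D = "{v \<in> daughters R w. \<not> (\<phi> \<in> lab v \<and> Box \<phi> \<in> lab v)}"
  let ?U = "{w} \<union> (\<Union>v\<in>daughters R w - ?D. cone R v)"
  have "openin (bouquet_topology T R) ?U"
    using assms(1) limit_rank_if_infinite_depth[OF assms(1) infinite_depth] countable_daughters
      \<open>infinite (daughters R w)\<close> finite_inaccurate_daughters[OF assms]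
    by (rule openin_bouquet_limit)
  moreover have "\<phi> \<in> lab u" if "u \<in> ?U - {w}" for u
  proof -
    obtain v where v: "(w, v) \<in> R" "\<phi> \<in> lab v" "Box \<phi> \<in> lab v" "u = v \<or> (v, u) \<in> R"
      using \<open>u \<in> ?U - {w}\<close> daughters_subset[of R w] by blast
    have "depth (lab v) < \<infinity>"
      using depth_less[OF v(1)] infinite_depth by simp
    then show ?thesis
      using v(2-) descends_lab accessibleD unfolding descends_def by blast
  qed
  ultimately show ?thesis
    by blast
qed

lemma refuting_limit_point:
  assumes "w \<in> T" "Box \<phi> \<notin> lab w"
  shows "w \<in> bouquet_topology T R derived_set_of {v \<in> T. \<phi> \<notin> lab v}"
  unfolding in_derived_set_of topspace_bouquet_topology[OF tree_nodes]
proof (intro conjI allI impI)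
  fix U assume "w \<in> U \<and> openin (bouquet_topology T R) U"
  then have "finite (daughters R w - U)"
    using bouquet_neighbourhood_cofinite[OF trans_R] by blast
  then have "infinite ({v \<in> daughters R w. \<phi> \<notin> lab v} - (daughters R w - U))"
    using Diff_infinite_finite infinite_refuting_daughters[OF assms] by blast
  then obtain v where v: "(w, v) \<in> R" "\<phi> \<notin> lab v" "v \<in> U"
    using infinite_imp_nonempty daughters_subset[of R w] by blast
  then show "\<exists>v. v \<noteq> w \<and> v \<in> {v \<in> T. \<phi> \<notin> lab v} \<and> v \<in> U"
    using R_mem R_irrefl by (intro exI[of _ v]) auto
qed (fact assms(1))

lemma Box_mem_lab_iff:
  assumes "w \<in> T"
  shows "Box \<phi> \<in> lab w \<longleftrightarrow> w \<notin> bouquet_topology T R derived_set_of {v \<in> T. \<phi> \<notin> lab v}"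
proof
  assume "Box \<phi> \<in> lab w"
  from Box_neighbourhood_exists[OF assms this] obtain U
    where U: "openin (bouquet_topology T R) U" "w \<in> U" "\<forall>u\<in>U - {w}. \<phi> \<in> lab u"
    by blast
  show "w \<notin> bouquet_topology T R derived_set_of {v \<in> T. \<phi> \<notin> lab v}"
    unfolding in_derived_set_of using U by blast
qed (use refuting_limit_point[OF assms] in blast)

lemma truth_lemma:
  "d_sem (bouquet_topology T R) (\<lambda>p. {w \<in> T. Var p \<in> lab w}) \<phi> = {w \<in> T. \<phi> \<in> lab w}"
proof (induction \<phi>)
  case (Var p)
  then show ?case
    by simp
next
  case Bot
  then show ?case
    using MCS_Bot[OF MCS_lab] by auto
next
  case (Neg \<phi>)
  then show ?case
    using MCS_Neg[OF MCS_lab] by (auto simp: topspace_bouquet_topology[OF tree_nodes])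
next
  case (Con \<phi> \<psi>)
  then show ?case
    using MCS_Con[OF MCS_lab] by auto
next
  case (Box \<phi>)
  have "T - {w \<in> T. \<phi> \<in> lab w} = {w \<in> T. \<phi> \<notin> lab w}"
    by blast
  with Box show ?case
    by (auto simp: topspace_bouquet_topology[OF tree_nodes] Box_mem_lab_iff)
qed

lemma satisfied_on_omega_bouquet:
  assumes "w \<in> T"
  shows "\<exists>X V. omega_bouquet X \<and> d_valuation X V \<and> w \<in> topspace X \<and>
    (\<forall>\<phi>\<in>lab w. w \<in> d_sem X V \<phi>)"
proof (intro exI conjI ballI)
  show "omega_bouquet (bouquet_topology T R)"
    unfolding omega_bouquet_def using countable_nodes tree_nodes wf_converse by blast
  show "d_valuation (bouquet_topology T R) (\<lambda>p. {w \<in> T. Var p \<in> lab w})"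
    by (auto simp: d_valuation_def topspace_bouquet_topology[OF tree_nodes])
qed (use assms in \<open>auto simp: topspace_bouquet_topology[OF tree_nodes] truth_lemma\<close>)

end


section \<open>Trees of lists\<close>

lemma treeI:
  assumes "R \<subseteq> T \<times> T" "trans R" "wf R"
    and comparable: "\<And>u v w. (u, w) \<in> R \<Longrightarrow> (v, w) \<in> R \<Longrightarrow> u \<noteq> v \<Longrightarrow> (u, v) \<in> R \<or> (v, u) \<in> R"
    and root: "r \<in> T" "\<And>w. w \<in> T \<Longrightarrow> w \<noteq> r \<Longrightarrow> (r, w) \<in> R"
  shows "tree T R"
proof -
  have irrefl: "(w, w) \<notin> R" for w
    using \<open>wf R\<close> by simp
  have "well_order_on P (Restr (R\<^sup>=) P)" if P: "P = {v. (v, w) \<in> R}" for P w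
  proof -
    have "refl_on P (Restr (R\<^sup>=) P)"
      by (auto simp: refl_on_def)
    moreover have "trans (Restr (R\<^sup>=) P)"
      using \<open>trans R\<close> by (intro trans_Restr) simp
    moreover have "antisym (Restr (R\<^sup>=) P)"
      using transD[OF \<open>trans R\<close>] irrefl unfolding antisym_def by blast
    moreover have "total_on P (Restr (R\<^sup>=) P)"
      using comparable unfolding P total_on_def by blast
    moreover have "wf (Restr (R\<^sup>=) P - Id)"
      by (rule wf_subset[OF \<open>wf R\<close>]) blast
    ultimately show ?thesis
      by (auto simp: well_order_on_def linear_order_on_def partial_order_on_def preorder_on_def)
  qed
  moreover have "\<exists>!r. r \<in> T \<and> (\<forall>v. (v, r) \<notin> R)"
  proof (rule ex1I[of _ r])
    show "r \<in> T \<and> (\<forall>v. (v, r) \<notin> R)"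
      using root assms(1) irrefl transD[OF \<open>trans R\<close>] by blast
  qed (use root in blast)
  ultimately show ?thesis
    using assms(1,2) irrefl by (simp add: tree_def irrefl_def)
qed

definition prefix_closed :: "'a list set \<Rightarrow> bool" where
  "prefix_closed L \<longleftrightarrow> (\<forall>ys\<in>L. \<forall>xs. prefix xs ys \<longrightarrow> xs \<in> L)"

definition coded_prefix :: "'a::countable list set \<Rightarrow> nat rel" where
  "coded_prefix L = {(to_nat xs, to_nat ys) | xs ys. xs \<in> L \<and> ys \<in> L \<and> strict_prefix xs ys}"

lemma coded_prefix_iff [simp]:
  "(to_nat xs, to_nat ys) \<in> coded_prefix L \<longleftrightarrow> xs \<in> L \<and> ys \<in> L \<and> strict_prefix xs ys"
  by (auto simp: coded_prefix_def)

lemma coded_prefixE: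
  assumes "(u, v) \<in> coded_prefix L"
  obtains xs ys where "u = to_nat xs" "v = to_nat ys" "xs \<in> L" "ys \<in> L" "strict_prefix xs ys"
  using assms by (auto simp: coded_prefix_def)

lemma tree_coded_prefix:
  fixes L :: "'a::countable list set"
  assumes "[] \<in> L"
  shows "tree (to_nat ` L) (coded_prefix L)"
proof (rule treeI)
  show "coded_prefix L \<subseteq> to_nat ` L \<times> to_nat ` L"
    by (auto elim!: coded_prefixE)
  show "trans (coded_prefix L)"
    by (rule transI) (auto elim!: coded_prefixE intro: prefix_order.less_trans)
  have "coded_prefix L \<subseteq> inv_image (measure length) (from_nat :: nat \<Rightarrow> 'a list)"
    by (auto elim!: coded_prefixE dest: prefix_length_less)
  then show "wf (coded_prefix L)"
    by (rule wf_subset[OF wf_inv_image[OF wf_measure]])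
  show "(u, v) \<in> coded_prefix L \<or> (v, u) \<in> coded_prefix L"
    if "(u, w) \<in> coded_prefix L" "(v, w) \<in> coded_prefix L" "u \<noteq> v" for u v w
  proof -
    obtain xs ys zs where "u = to_nat xs" "v = to_nat ys" "xs \<noteq> ys" "xs \<in> L" "ys \<in> L"
        "prefix xs zs" "prefix ys zs"
      using \<open>(u, w) \<in> _\<close> \<open>(v, w) \<in> _\<close> \<open>u \<noteq> v\<close>
      by (auto elim!: coded_prefixE simp: strict_prefix_def)
    then show ?thesis
      using prefix_same_cases[of xs zs ys] by (auto simp: strict_prefix_def)
  qed
  show "to_nat ([] :: 'a list) \<in> to_nat ` L"
    using assms by blast
  show "(to_nat ([] :: 'a list), w) \<in> coded_prefix L"
    if "w \<in> to_nat ` L" "w \<noteq> to_nat ([] :: 'a list)" for w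
    using that assms by (auto simp: strict_prefix_def)
qed

lemma strict_prefix_snoc_iff: "strict_prefix xs (ys @ [y]) \<longleftrightarrow> prefix xs ys"
  by (auto simp: strict_prefix_def)

lemma daughters_coded_prefix:
  assumes "prefix_closed L" "xs \<in> L"
  shows "daughters (coded_prefix L) (to_nat xs) = (\<lambda>x. to_nat (xs @ [x])) ` {x. xs @ [x] \<in> L}"
proof (intro equalityI subsetI)
  fix v assume v: "v \<in> daughters (coded_prefix L) (to_nat xs)"
  then obtain ys where ys: "v = to_nat ys" "ys \<in> L" "strict_prefix xs ys"
    by (auto simp: daughters_def elim!: coded_prefixE)
  then obtain x where x: "prefix (xs @ [x]) ys"
    by (auto elim: strict_prefixE')
  then have "xs @ [x] \<in> L"
    using assms(1) ys(2) by (simp add: prefix_closed_def)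
  moreover from this have "(to_nat xs, to_nat (xs @ [x])) \<in> coded_prefix L"
    using assms(2) by (simp add: strict_prefix_snoc_iff)
  then have "(to_nat (xs @ [x]), v) \<notin> coded_prefix L"
    using v by (auto simp: daughters_def)
  then have "ys = xs @ [x]"
    using x ys \<open>xs @ [x] \<in> L\<close> by (auto simp: strict_prefix_def)
  ultimately show "v \<in> (\<lambda>x. to_nat (xs @ [x])) ` {x. xs @ [x] \<in> L}"
    using ys(1) by blast
next
  fix v assume "v \<in> (\<lambda>x. to_nat (xs @ [x])) ` {x. xs @ [x] \<in> L}"
  then show "v \<in> daughters (coded_prefix L) (to_nat xs)"
    using assms(2)
    by (auto simp: daughters_def strict_prefix_snoc_iff elim!: coded_prefixE
        dest: prefix_order.less_le_trans)
qed


section \<open>The tree of approximate successors\<close>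

text \<open>
  The first component of a step \<open>(n, \<psi>)\<close> only serves to provide infinitely many witnesses
  against \<open>\<box>\<psi>\<close>, whose accuracy is unbounded because \<open>(n, \<psi>) \<mapsto> to_nat (n, \<psi>)\<close> is injective.
\<close>

definition next_theory :: "'p::countable fm set \<Rightarrow> nat \<times> 'p fm \<Rightarrow> 'p fm set" where
  "next_theory \<Delta> x = (SOME \<Theta>. approx_successor (to_nat x) \<Delta> (snd x) \<Theta>)"

lemma approx_successor_next_theory:
  assumes "MCS \<Delta>" "Box (snd x) \<notin> \<Delta>"
  shows "approx_successor (to_nat x) \<Delta> (snd x) (next_theory \<Delta> x)"
  unfolding next_theory_def using approx_successor_exists[OF assms] by (rule someI_ex)

definition path_theory :: "'p::countable fm set \<Rightarrow> (nat \<times> 'p fm) list \<Rightarrow> 'p fm set" where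
  "path_theory \<Gamma> xs = foldl next_theory \<Gamma> xs"

lemma path_theory_Nil [simp]: "path_theory \<Gamma> [] = \<Gamma>"
  and path_theory_snoc: "path_theory \<Gamma> (xs @ [x]) = next_theory (path_theory \<Gamma> xs) x"
  by (simp_all add: path_theory_def)

inductive_set paths :: "'p::countable fm set \<Rightarrow> (nat \<times> 'p fm) list set" for \<Gamma> where
  Nil: "[] \<in> paths \<Gamma>"
| snoc: "xs \<in> paths \<Gamma> \<Longrightarrow> Box (snd x) \<notin> path_theory \<Gamma> xs \<Longrightarrow> xs @ [x] \<in> paths \<Gamma>"

lemma paths_snoc_iff: "xs @ [x] \<in> paths \<Gamma> \<longleftrightarrow> xs \<in> paths \<Gamma> \<and> Box (snd x) \<notin> path_theory \<Gamma> xs"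
  by (auto intro: paths.snoc elim: paths.cases)

lemma prefix_closed_paths: "prefix_closed (paths \<Gamma>)"
proof -
  have "xs \<in> paths \<Gamma>" if "ys \<in> paths \<Gamma>" "prefix xs ys" for xs ys
    using that by (induction rule: paths.induct) (auto intro: paths.intros)
  then show ?thesis
    by (simp add: prefix_closed_def)
qed

locale path_tree =
  fixes \<Gamma> :: "'p::countable fm set"
  assumes MCS_root: "MCS \<Gamma>"
begin

lemma MCS_path_theory:
  assumes "xs \<in> paths \<Gamma>"
  shows "MCS (path_theory \<Gamma> xs)"
  using assms
proof (induction rule: paths.induct)
  case Nil
  then show ?case
    by (simp add: MCS_root)
next
  case (snoc xs x)
  then show ?case
    using approx_successor_next_theory[OF snoc.IH snoc.hyps(2)]
    by (simp add: path_theory_snoc approx_successor_def)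
qed

lemma approx_successor_path_theory:
  assumes "xs @ [x] \<in> paths \<Gamma>"
  shows "approx_successor (to_nat x) (path_theory \<Gamma> xs) (snd x) (path_theory \<Gamma> (xs @ [x]))"
  using assms approx_successor_next_theory[OF MCS_path_theory]
  by (simp add: paths_snoc_iff path_theory_snoc)

lemma descends_path_theory:
  assumes "ys \<in> paths \<Gamma>" "strict_prefix xs ys"
  shows "descends (path_theory \<Gamma> xs) (path_theory \<Gamma> ys)"
  using assms
proof (induction rule: paths.induct)
  case (snoc ys y)
  then have last: "descends (path_theory \<Gamma> ys) (path_theory \<Gamma> (ys @ [y]))"
    using approx_successor_path_theory[OF paths.snoc] by (simp add: approx_successor_def)
  show ?case
  proof (cases "xs = ys")
    case False
    then have "strict_prefix xs ys"
      using snoc.prems by (auto simp: strict_prefix_snoc_iff strict_prefix_def)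
    then show ?thesis
      using descends_trans[OF snoc.IH last] by blast
  qed (simp add: last)
qed simp

lemma finite_inaccurate_steps:
  assumes "Box \<phi> \<in> path_theory \<Gamma> xs"
  shows "finite {x. xs @ [x] \<in> paths \<Gamma> \<and>
    \<not> (\<phi> \<in> path_theory \<Gamma> (xs @ [x]) \<and> Box \<phi> \<in> path_theory \<Gamma> (xs @ [x]))}" (is "finite ?S")
proof (rule finite_subset)
  show "?S \<subseteq> to_nat -` {..to_nat \<phi>}"
    using approx_successor_path_theory assms by (force simp: approx_successor_def)
  show "finite (to_nat -` {..to_nat \<phi>} :: (nat \<times> 'p fm) set)"
    by (rule finite_vimageI) auto
qed

lemma infinite_refuting_steps:
  assumes "xs \<in> paths \<Gamma>" "Box \<phi> \<notin> path_theory \<Gamma> xs"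
  shows "infinite {x. xs @ [x] \<in> paths \<Gamma> \<and> \<phi> \<notin> path_theory \<Gamma> (xs @ [x])}" (is "infinite ?S")
proof (rule infinite_super)
  have "xs @ [(n, \<phi>)] \<in> paths \<Gamma>" for n
    using assms by (simp add: paths_snoc_iff)
  then show "(\<lambda>n. (n, \<phi>)) ` UNIV \<subseteq> ?S"
    using approx_successor_path_theory by (fastforce simp: approx_successor_def)
  show "infinite ((\<lambda>n::nat. (n, \<phi>)) ` UNIV)"
    by (simp add: finite_image_iff inj_on_def)
qed

lemma canonical_bouquet_paths:
  "canonical_bouquet (to_nat ` paths \<Gamma>) (coded_prefix (paths \<Gamma>)) (\<lambda>w. path_theory \<Gamma> (from_nat w))"
proof
  let ?R = "coded_prefix (paths \<Gamma>)" and ?lab = "\<lambda>w. path_theory \<Gamma> (from_nat w)"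
  show "countable (to_nat ` paths \<Gamma>)"
    by simp
  show "tree (to_nat ` paths \<Gamma>) ?R"
    by (rule tree_coded_prefix) (rule paths.Nil)
  show "descends (?lab w) (?lab v)" if "(w, v) \<in> ?R" for w v
    using that descends_path_theory by (auto elim!: coded_prefixE)
  fix w \<phi> assume "w \<in> to_nat ` paths \<Gamma>"
  then obtain xs where xs: "w = to_nat xs" "xs \<in> paths \<Gamma>"
    by blast
  have daughters: "{v \<in> daughters ?R w. P (?lab v)} =
      (\<lambda>x. to_nat (xs @ [x])) ` {x. xs @ [x] \<in> paths \<Gamma> \<and> P (path_theory \<Gamma> (xs @ [x]))}" for P
    unfolding xs(1) daughters_coded_prefix[OF prefix_closed_paths xs(2)] by auto
  show "MCS (?lab w)"
    using MCS_path_theory[OF xs(2)] by (simp add: xs(1))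
  show "finite {v \<in> daughters ?R w. \<not> (\<phi> \<in> ?lab v \<and> Box \<phi> \<in> ?lab v)}" if "Box \<phi> \<in> ?lab w"
    using finite_inaccurate_steps[of \<phi> xs] that
      daughters[of "\<lambda>\<Delta>. \<not> (\<phi> \<in> \<Delta> \<and> Box \<phi> \<in> \<Delta>)"] by (simp add: xs(1))
  show "infinite {v \<in> daughters ?R w. \<phi> \<notin> ?lab v}" if "Box \<phi> \<notin> ?lab w"
    using infinite_refuting_steps[OF xs(2), of \<phi>] that daughters[of "\<lambda>\<Delta>. \<phi> \<notin> \<Delta>"]
    by (simp add: xs(1) finite_image_iff inj_on_def)
qed

end

theorem theorem4p9:
  fixes \<Gamma> :: "'p::countable fm set"
  assumes "GL_consistent \<Gamma>"
  shows "\<exists>(X :: nat topology) (V :: 'p \<Rightarrow> nat set) x.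
           omega_bouquet X \<and> d_valuation X V \<and> x \<in> topspace X \<and>
           (\<forall>\<phi>\<in>\<Gamma>. x \<in> d_sem X V \<phi>)"
proof -
  obtain \<Delta> where "\<Gamma> \<subseteq> \<Delta>" "MCS \<Delta>"
    using Lindenbaum[OF assms] by blast
  interpret path_tree \<Delta>
    by unfold_locales (rule \<open>MCS \<Delta>\<close>)
  interpret canonical_bouquet "to_nat ` paths \<Delta>" "coded_prefix (paths \<Delta>)"
    "\<lambda>w. path_theory \<Delta> (from_nat w)"
    by (rule canonical_bouquet_paths)
  let ?root = "to_nat ([] :: (nat \<times> 'p fm) list)"
  have "?root \<in> to_nat ` paths \<Delta>"
    using paths.Nil by blast
  from satisfied_on_omega_bouquet[OF this] obtain X and V :: "'p \<Rightarrow> nat set"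
    where "omega_bouquet X" "d_valuation X V" "?root \<in> topspace X"
      and "\<forall>\<phi>\<in>\<Delta>. ?root \<in> d_sem X V \<phi>"
    by auto
  with \<open>\<Gamma> \<subseteq> \<Delta>\<close> show ?thesis
    by blast
qed

end
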